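(* Every graph in the class $\varepsilon_2$ is planar.
   Context: All graphs are finite, simple, undirected and connected. An Euler graph is a connected graph in which every vertex has even degree. $\varepsilon_2$ denotes the class of Euler graphs $G$ such that every cycle of $G$ has length $n\equiv 2 \pmod 4$. *)

theory Defs
  imports "HOL-Analysis.Analysis" "Graph_Theory.Digraph_Component"
begin

text \<open>
  Following the convention of \<^theory>\<open>Graph_Theory.Digraph\<close>, a finite simple undirected graph is
  represented as a finite loop-free symmetric digraph without parallel arcs (locale
  \<^locale>\<open>graph\<close>): every undirected edge corresponds to a pair of mutually reverse arcs.  In
  particular the degree of a vertex is its out-degree.
\<close>

definition euler_graph :: "('a, 'b) pre_digraph \<Rightarrow> bool" where
  "euler_graph G \<longleftrightarrow>
     graph G \<and> Digraph_Component.connected G \<and> (\<forall>v \<in> verts G. even (out_degree G v))"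

text \<open>
  The library notion of a cycle, read in a symmetric digraph, also admits walking back and forth
  along a single edge; this is excluded by the bound on the length.
\<close>

definition undirected_cycle :: "('a, 'b) pre_digraph \<Rightarrow> 'b list \<Rightarrow> bool" where
  "undirected_cycle G p \<longleftrightarrow> pre_digraph.cycle G p \<and> length p \<ge> 3"

definition eps2 :: "('a, 'b) pre_digraph set" where
  "eps2 = {G. euler_graph G \<and> (\<forall>p. undirected_cycle G p \<longrightarrow> length p mod 4 = 2)}"

definition undirected_edges :: "('a, 'b) pre_digraph \<Rightarrow> 'a set set" where
  "undirected_edges G = {{u, v} | u v. (u, v) \<in> arcs_ends G}"

text \<open>
  A drawing without crossings: distinct vertices are distinct points, each undirected edge is a
  simple arc joining its two end points and meeting no further vertex, and two different edges
  meet at most in common end points.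
\<close>

definition plane_drawing ::
  "('a, 'b) pre_digraph \<Rightarrow> ('a \<Rightarrow> complex) \<Rightarrow> ('a set \<Rightarrow> real \<Rightarrow> complex) \<Rightarrow> bool" where
  "plane_drawing G pos \<gamma> \<longleftrightarrow>
     inj_on pos (verts G) \<and>
     (\<forall>e \<in> undirected_edges G.
        arc (\<gamma> e) \<and>
        {pathstart (\<gamma> e), pathfinish (\<gamma> e)} = pos ` e \<and>
        path_image (\<gamma> e) \<inter> pos ` verts G = pos ` e) \<and>
     (\<forall>e \<in> undirected_edges G. \<forall>f \<in> undirected_edges G. e \<noteq> f \<longrightarrow>
        path_image (\<gamma> e) \<inter> path_image (\<gamma> f) = pos ` (e \<inter> f))"

definition planar :: "('a, 'b) pre_digraph \<Rightarrow> bool" where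
  "planar G \<longleftrightarrow> (\<exists>pos \<gamma>. plane_drawing G pos \<gamma>)"

end

theory Submission
  imports Defs
begin

text \<open>
  Parities exclude a subdivision of \<open>K\<^sub>4\<close>: the three arms of a theta have odd length, congruent
  modulo 4, and the thetas inside a subdivided \<open>K\<^sub>4\<close> make these conditions contradictory. Hence if a
  connected vertex set \<open>U\<close> has all its outside neighbours in \<open>{u, w}\<close>, and \<open>u\<close>, \<open>w\<close> are also
  joined outside \<open>U\<close>, then some \<open>x \<in> U\<close> separates \<open>u\<close> from \<open>w\<close> in \<open>U\<close>: otherwise there are two
  disjoint paths from \<open>u\<close> to \<open>w\<close> through \<open>U\<close>, linked inside \<open>U\<close>, and the path outside completes a
  subdivided \<open>K\<^sub>4\<close>. Each component of \<open>U - {x}\<close> then hangs on \<open>{x, u}\<close> or on \<open>{x, w}\<close>, which leads to a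
  recursive straight-line drawing: put \<open>x\<close> next to the midpoint of the already drawn segment \<open>uw\<close>,
  draw \<open>xu\<close> and \<open>xw\<close>, and continue with the components.
\<close>

section \<open>Straight-line drawings\<close>

text \<open>A second common point \<open>z\<close> would determine the line through \<open>a\<close>
  and \<open>b\<close>, and \<open>c\<close> would lie on it.\<close>

lemma segment_Int_off_line:
  fixes a b c :: complex
  assumes "c \<notin> affine hull {a, b}"
  shows "closed_segment a c \<inter> closed_segment a b = {a}"
proof -
  have "z = a" if "z \<in> closed_segment a c" "z \<in> closed_segment a b" for z
  proof (rule ccontr)
    assume "z \<noteq> a"
    have "collinear {a, c, z}" using that(1) by (metis collinear_between_cases between_mem_segment insert_commute)
    then have "c \<in> affine hull {a, z}"
      using \<open>z \<noteq> a\<close> collinear_3_affine_hull by (metis insert_commute)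
    moreover have "z \<in> affine hull {a, b}"
      using that(2) convex_hull_subset_affine_hull segment_convex_hull by blast
    then have "affine hull {a, z} \<subseteq> affine hull {a, b}"
      by (intro hull_minimal) (auto simp: hull_inc affine_affine_hull)
    ultimately show False using assms by blast
  qed
  then show ?thesis by auto
qed

text \<open>Disjoint compact sets have positive distance, and moving the end \<open>m\<close> to
  \<open>q\<close> moves no point of the segment by more than \<open>dist m q\<close>.\<close>

lemma near_segment_avoids:
  fixes a m :: complex
  assumes "compact K" "closed_segment a m \<inter> K = {}"
  obtains e where "e > 0" "\<And>q. dist m q < e \<Longrightarrow> closed_segment a q \<inter> K = {}"
proof -
  obtain e where e: "e > 0" "\<And>x y. x \<in> closed_segment a m \<Longrightarrow> y \<in> K \<Longrightarrow> e \<le> dist x y"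
    using separate_compact_closed[OF compact_segment compact_imp_closed[OF assms(1)] assms(2)] by blast
  have "closed_segment a q \<inter> K = {}" if "dist m q < e" for q
  proof (rule ccontr)
    assume "closed_segment a q \<inter> K \<noteq> {}"
    then obtain t where t: "0 \<le> t" "t \<le> 1" "(1 - t) *\<^sub>R a + t *\<^sub>R q \<in> K"
      by (auto simp: closed_segment_def)
    have "(1 - t) *\<^sub>R a + t *\<^sub>R m \<in> closed_segment a m" using t by (auto simp: closed_segment_def)
    then have "e \<le> dist ((1 - t) *\<^sub>R a + t *\<^sub>R m) ((1 - t) *\<^sub>R a + t *\<^sub>R q)" using e t by blast
    also have "\<dots> = norm (t *\<^sub>R (m - q))" by (simp add: dist_norm scaleR_diff_right)
    also have "\<dots> = t * dist m q" using t by (simp add: dist_norm)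
    also have "\<dots> \<le> dist m q" using t by (simp add: mult_left_le_one_le)
    finally show False using that by simp
  qed
  then show thesis using that e(1) by blast
qed

text \<open>Finitely many lines form a null set and a ball does not. The case \<open>a = b\<close>
  is included, so \<open>q\<close> also differs from all points of \<open>P\<close>.\<close>

lemma ball_avoids_lines:
  fixes m :: complex
  assumes "finite P" "e > 0"
  obtains q where "dist m q < e" "\<And>a b. a \<in> P \<Longrightarrow> b \<in> P \<Longrightarrow> q \<notin> affine hull {a, b}"
proof -
  have "negligible (affine hull {a, b})" for a b :: complex
  proof -
    have "interior (affine hull {a, b}) = {}"
      by (rule empty_interior_affine_hull) (auto simp: card_insert_if)
    then show ?thesis by (simp add: negligible_convex_interior affine_imp_convex)
  qed
  then have "negligible (\<Union>(a, b)\<in>P \<times> P. affine hull {a, b})"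
    using assms(1) by (intro negligible_Union) auto
  moreover have "\<not> negligible (ball m e)" using assms(2) by (intro open_not_negligible) auto
  ultimately have "\<not> ball m e \<subseteq> (\<Union>(a, b)\<in>P \<times> P. affine hull {a, b})"
    using negligible_subset by blast
  then show thesis using that by (auto simp: subset_iff)
qed

section \<open>Straight-line drawings and insertion of a vertex near an edge\<close>

text \<open>Edges are sets, so a segment is written as the convex hull of the images of its ends,
  without choosing an order.\<close>

definition straight_drawing :: "'a set \<Rightarrow> 'a set set \<Rightarrow> ('a \<Rightarrow> complex) \<Rightarrow> bool" where
  "straight_drawing W F pos \<longleftrightarrow> inj_on pos W \<and>
     (\<forall>e\<in>F. convex hull (pos ` e) \<inter> pos ` W = pos ` e) \<and>
     (\<forall>e\<in>F. \<forall>f\<in>F. e \<noteq> f \<longrightarrow> convex hull (pos ` e) \<inter> convex hull (pos ` f) = pos ` (e \<inter> f))"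

text \<open>\<open>F\<close> may contain pairs that are not edges of the graph: such auxiliary
  segments carry later pieces of the drawing.\<close>

definition straight_drawable :: "'a set \<Rightarrow> 'a set set \<Rightarrow> bool" where
  "straight_drawable W F \<longleftrightarrow> finite W \<and> (\<forall>e\<in>F. e \<subseteq> W \<and> card e = 2) \<and> (\<exists>pos. straight_drawing W F pos)"

lemma hull_image_pair: "convex hull (pos ` {a, b}) = closed_segment (pos a) (pos b)"
  by (simp add: segment_convex_hull)

lemma straight_drawable_edge: "u \<noteq> w \<Longrightarrow> straight_drawable {u, w} {{u, w}}"
  unfolding straight_drawable_def straight_drawing_def
  by (auto simp: segment_convex_hull[symmetric] intro!: exI[of _ "\<lambda>x. if x = u then 0 else 1"])

text \<open>Each half of the segment \<open>uw\<close> has positive distance from all vertices and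
  edges not at its own end, so it can be tilted slightly. A generic choice of the new point near the
  midpoint settles the edges that share an end.\<close>

lemma straight_drawable_extend:
  assumes dr: "straight_drawable W F" and uw: "{u, w} \<in> F" and v: "v \<notin> W"
  shows "straight_drawable (insert v W) (insert {v, u} (insert {v, w} F))"
proof -
  obtain pos where W: "finite W" and F: "\<And>e. e \<in> F \<Longrightarrow> e \<subseteq> W \<and> card e = 2"
    and "straight_drawing W F pos"
    using dr unfolding straight_drawable_def by blast
  then have inj: "inj_on pos W"
    and vert: "\<And>e. e \<in> F \<Longrightarrow> convex hull (pos ` e) \<inter> pos ` W = pos ` e"
    and cross: "\<And>e f. e \<in> F \<Longrightarrow> f \<in> F \<Longrightarrow> e \<noteq> f \<Longrightarrow> convex hull (pos ` e) \<inter> convex hull (pos ` f) = pos ` (e \<inter> f)"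
    unfolding straight_drawing_def by blast+
  have "u \<in> W" "w \<in> W" "u \<noteq> w" using F[OF uw] by (auto simp: card_2_iff)
  then have puw: "pos u \<noteq> pos w" using inj by (auto simp: inj_on_def)
  have finF: "finite F" using F W by (meson PowI finite_Pow_iff finite_subset subsetI)
  define m where "m = midpoint (pos u) (pos w)"
  \<comment> \<open>\<open>K x\<close> is what a new segment starting at \<open>pos x\<close> must
    avoid: the other vertices and the edges not incident to \<open>x\<close>.\<close>
  define K where "K x = pos ` (W - {x}) \<union> (\<Union>e\<in>{e\<in>F. x \<notin> e}. convex hull (pos ` e))" for x
  have cK: "compact (K x)" for x
  proof -
    have "compact (convex hull (pos ` e))" if "e \<in> F" for e
      using F[OF that] W by (intro compact_convex_hull finite_imp_compact) (auto intro: finite_subset)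
    then have "compact (\<Union>e\<in>{e\<in>F. x \<notin> e}. convex hull (pos ` e))"
      using finF by (intro compact_UN) auto
    moreover have "compact (pos ` (W - {x}))" using W by (intro finite_imp_compact) auto
    ultimately show ?thesis unfolding K_def by (intro compact_Un)
  qed
  have half: "closed_segment (pos x) m \<inter> K x = {}" if xy: "{x, y} = {u, w}" for x y
  proof -
    have xyF: "{x, y} \<in> F" "x \<noteq> y"
      using xy uw \<open>u \<noteq> w\<close> by (simp, auto simp: doubleton_eq_iff)
    then have xW: "x \<in> W" "y \<in> W" using F by auto
    then have pxy: "pos x \<noteq> pos y" using inj xyF(2) by (auto simp: inj_on_def)
    have m: "m = midpoint (pos x) (pos y)" using xy by (auto simp: m_def doubleton_eq_iff midpoint_sym)
    then have sub: "closed_segment (pos x) m \<subseteq> convex hull (pos ` {x, y})"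
      unfolding hull_image_pair by (simp add: subset_closed_segment)
    have ny: "pos y \<notin> closed_segment (pos x) m"
    proof
      assume "pos y \<in> closed_segment (pos x) m"
      then have "dist (pos x) (pos y) \<le> dist (pos x) m"
        using dist_in_closed_segment by (metis dist_commute)
      then show False using pxy by (simp add: m dist_midpoint)
    qed
    \<comment> \<open>The whole edge meets \<open>K x\<close> at most in its far end, which lies
      beyond the midpoint.\<close>
    have "convex hull (pos ` {x, y}) \<inter> K x \<subseteq> {pos y}"
    proof
      fix z assume z: "z \<in> convex hull (pos ` {x, y}) \<inter> K x"
      then consider "z \<in> pos ` (W - {x})" | e where "e \<in> F" "x \<notin> e" "z \<in> convex hull (pos ` e)"
        unfolding K_def by blast
      then show "z \<in> {pos y}"
      proof cases
        case 1
        then have "z \<in> pos ` {x, y}" using z vert[OF xyF(1)] by auto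
        then show ?thesis using 1 inj xW by (auto simp: inj_on_def)
      next
        case 2
        then have "z \<in> pos ` ({x, y} \<inter> e)" using z cross[OF xyF(1) 2(1)] by auto
        then show ?thesis using 2 by auto
      qed
    qed
    then show ?thesis using sub ny by blast
  qed
  obtain e1 where e1: "e1 > 0" "\<And>q. dist m q < e1 \<Longrightarrow> closed_segment (pos u) q \<inter> K u = {}"
    using near_segment_avoids[OF cK half] by (metis insert_commute)
  obtain e2 where e2: "e2 > 0" "\<And>q. dist m q < e2 \<Longrightarrow> closed_segment (pos w) q \<inter> K w = {}"
    using near_segment_avoids[OF cK half] by (metis insert_commute)
  \<comment> \<open>Closeness to \<open>m\<close> keeps the new segments off \<open>K u\<close> and
    \<open>K w\<close>. Lying on no line through drawn vertices separates them from old edges at the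
    same end and from each other.\<close>
  obtain q where q: "dist m q < min e1 e2" and
    line: "\<And>a b. a \<in> pos ` W \<Longrightarrow> b \<in> pos ` W \<Longrightarrow> q \<notin> affine hull {a, b}"
    using ball_avoids_lines[of "pos ` W" "min e1 e2" m] W e1(1) e2(1) by auto
  have Kx: "closed_segment (pos x) q \<inter> K x = {}" if "x \<in> {u, w}" for x
    using that e1(2) e2(2) q by auto
  have qhull: "q \<notin> convex hull (pos ` e)" if e: "e \<in> F" for e
  proof -
    obtain a b where "e = {a, b}" using F[OF e] by (auto simp: card_2_iff)
    then show ?thesis using line[of "pos a" "pos b"] F[OF e]
      convex_hull_subset_affine_hull[of "{pos a, pos b}"] by auto
  qed
  have qW: "q \<notin> pos ` W" using line by (metis hull_inc insertI1)
  define pos' where "pos' = pos(v := q)"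
  have pv: "pos' v = q" by (simp add: pos'_def)
  have old1: "pos' x = pos x" if "x \<in> W" for x using that v by (auto simp: pos'_def)
  have old: "pos' ` e = pos ` e" if "e \<subseteq> W" for e
    using that old1 by (intro image_cong) auto
  have newv: "pos' ` {v, x} = {pos x, q}" if "x \<in> W" for x
    using pv old1[OF that] by auto
  then have new: "convex hull (pos' ` {v, x}) = closed_segment (pos x) q" if "x \<in> W" for x
    using that by (simp add: segment_convex_hull)
  have inj': "inj_on pos' (insert v W)"
    using inj qW v old[of W] inj_on_cong[of W pos' pos] old1 pv by simp
  have oldvert: "convex hull (pos' ` e) \<inter> pos' ` insert v W = pos' ` e" if "e \<in> F" for e
    using vert[OF that] qhull[OF that] F[OF that] old[of e] old[of W] pv by auto
  have newvert: "convex hull (pos' ` {v, x}) \<inter> pos' ` insert v W = pos' ` {v, x}" if "x \<in> {u, w}" for x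
  proof -
    have x: "x \<in> W" using that \<open>u \<in> W\<close> \<open>w \<in> W\<close> by auto
    have "closed_segment (pos x) q \<inter> pos ` (W - {x}) = {}" using Kx[OF that] unfolding K_def by auto
    moreover have "pos' ` insert v W = insert q (insert (pos x) (pos ` (W - {x})))"
      using old[of W] x pv by auto
    ultimately show ?thesis unfolding newv[OF x] segment_convex_hull[symmetric] by auto
  qed
  have newold: "convex hull (pos' ` {v, x}) \<inter> convex hull (pos' ` e) = pos' ` ({v, x} \<inter> e)"
    if xuw: "x \<in> {u, w}" and eF: "e \<in> F" for x e
  proof -
    have x: "x \<in> W" using xuw \<open>u \<in> W\<close> \<open>w \<in> W\<close> by auto
    have ve: "v \<notin> e" using F[OF eF] v by auto
    show ?thesis
    proof (cases "x \<in> e")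
      case True
      then obtain y where y: "e = {x, y}" using F[OF eF] by (auto simp: card_2_iff)
      then have "closed_segment (pos x) q \<inter> closed_segment (pos x) (pos y) = {pos x}"
        using F[OF eF] by (intro segment_Int_off_line line) auto
      moreover have "pos' ` ({v, x} \<inter> e) = {pos x}" using True ve old1[OF x] by auto
      moreover have "pos' ` e = pos ` {x, y}" using old[of e] F[OF eF] y by simp
      ultimately show ?thesis unfolding new[OF x] by (simp only: hull_image_pair)
    next
      case False
      then have "{v, x} \<inter> e = {}" using ve by auto
      moreover have "closed_segment (pos x) q \<inter> convex hull (pos ` e) = {}"
        using Kx[OF xuw] False eF unfolding K_def by auto
      ultimately show ?thesis unfolding new[OF x] using old[of e] F[OF eF] by simp
    qed
  qed
  have newnew: "convex hull (pos' ` {v, u}) \<inter> convex hull (pos' ` {v, w}) = pos' ` ({v, u} \<inter> {v, w})"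
  proof -
    have "pos u \<notin> affine hull {q, pos w}"
    proof
      assume "pos u \<in> affine hull {q, pos w}"
      moreover have "q \<noteq> pos w" using qW \<open>w \<in> W\<close> by auto
      ultimately have "collinear {pos u, pos w, q}"
        using collinear_3_affine_hull by (metis insert_commute)
      then show False using puw line[of "pos u" "pos w"] \<open>u \<in> W\<close> \<open>w \<in> W\<close> collinear_3_affine_hull by blast
    qed
    then have "closed_segment q (pos u) \<inter> closed_segment q (pos w) = {q}"
      by (rule segment_Int_off_line)
    moreover have "{v, u} \<inter> {v, w} = {v}" using \<open>u \<noteq> w\<close> by auto
    then have "pos' ` ({v, u} \<inter> {v, w}) = {q}" using pv by (simp only:) simp
    ultimately show ?thesis unfolding new[OF \<open>u \<in> W\<close>] new[OF \<open>w \<in> W\<close>]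
      by (simp only: closed_segment_commute)
  qed
  have oldold: "convex hull (pos' ` e) \<inter> convex hull (pos' ` f) = pos' ` (e \<inter> f)"
    if "e \<in> F" "f \<in> F" "e \<noteq> f" for e f
    using cross[OF that] old[of e] old[of f] old[of "e \<inter> f"] F that by (metis le_infI1)
  have "straight_drawing (insert v W) (insert {v, u} (insert {v, w} F)) pos'"
    unfolding straight_drawing_def
  proof (intro conjI ballI impI)
    show "inj_on pos' (insert v W)" by (rule inj')
  next
    fix e assume "e \<in> insert {v, u} (insert {v, w} F)"
    then consider "e \<in> F" | "e = {v, u}" | "e = {v, w}" by blast
    then show "convex hull (pos' ` e) \<inter> pos' ` insert v W = pos' ` e"
    proof cases
      case 1 then show ?thesis by (rule oldvert)
    next
      case 2 then show ?thesis using newvert[of u] by simp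
    next
      case 3 then show ?thesis using newvert[of w] by simp
    qed
  next
    fix e f assume "e \<in> insert {v, u} (insert {v, w} F)" "f \<in> insert {v, u} (insert {v, w} F)" "e \<noteq> f"
    then consider "e \<in> F" "f \<in> F" | x where "x \<in> {u, w}" "e = {v, x}" "f \<in> F"
      | x where "x \<in> {u, w}" "f = {v, x}" "e \<in> F" | "e = {v, u}" "f = {v, w}" | "e = {v, w}" "f = {v, u}"
      by blast
    then show "convex hull (pos' ` e) \<inter> convex hull (pos' ` f) = pos' ` (e \<inter> f)"
    proof cases
      case 1 then show ?thesis using \<open>e \<noteq> f\<close> by (rule oldold)
    next
      case 2 then show ?thesis using newold[OF 2(1,3)] by simp
    next
      case 3 then show ?thesis using newold[OF 3(1,3)] by (simp only: Int_commute)
    next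
      case 4 then show ?thesis using newnew by (simp only:)
    next
      case 5 then show ?thesis using newnew by (simp only: Int_commute)
    qed
  qed
  moreover have "e \<subseteq> insert v W \<and> card e = 2" if "e \<in> insert {v, u} (insert {v, w} F)" for e
    using that F v \<open>u \<in> W\<close> \<open>w \<in> W\<close> by (auto simp: card_insert_if)
  ultimately show ?thesis using W unfolding straight_drawable_def by blast
qed

lemma straight_drawable_no_edges:
  assumes W: "finite W"
  shows "straight_drawable W {}"
proof -
  obtain f :: "_ \<Rightarrow> nat" where "inj_on f W" using finite_imp_inj_to_nat_seg[OF W] by blast
  then have "inj_on (\<lambda>x. of_nat (f x) :: complex) W" by (auto simp: inj_on_def)
  then show ?thesis using W unfolding straight_drawable_def straight_drawing_def by auto
qed

text \<open>The auxiliary segments are dropped, and each remaining one is parametrized from an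
  arbitrarily chosen end.\<close>

lemma planar_of_straight_drawable:
  assumes "straight_drawable (verts G) F" "undirected_edges G \<subseteq> F"
  shows "planar G"
proof -
  obtain pos where F: "\<And>e. e \<in> F \<Longrightarrow> e \<subseteq> verts G \<and> card e = 2" and
    pos: "straight_drawing (verts G) F pos"
    using assms(1) unfolding straight_drawable_def by blast
  have "\<exists>a b. e = {a, b} \<and> pos a \<noteq> pos b" if "e \<in> F" for e
    using F[OF that] pos unfolding straight_drawing_def card_2_iff by (metis inj_onD insert_subset)
  then obtain a b where ab: "\<And>e. e \<in> F \<Longrightarrow> e = {a e, b e} \<and> pos (a e) \<noteq> pos (b e)" by metis
  define g where "g e = linepath (pos (a e)) (pos (b e))" for e
  have im: "path_image (g e) = convex hull (pos ` e)" "arc (g e)"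
      "{pathstart (g e), pathfinish (g e)} = pos ` e" if "e \<in> F" for e
  proof -
    have *: "pos ` e = {pos (a e), pos (b e)}" using ab[OF that] by (metis image_empty image_insert)
    show "path_image (g e) = convex hull (pos ` e)" "{pathstart (g e), pathfinish (g e)} = pos ` e"
      unfolding * g_def by (simp_all add: segment_convex_hull)
    show "arc (g e)" using ab[OF that] by (simp add: g_def)
  qed
  have "plane_drawing G pos g"
    unfolding plane_drawing_def using pos assms(2) im
    unfolding straight_drawing_def by (simp add: subset_iff)
  then show ?thesis unfolding planar_def by blast
qed

section \<open>Paths and separation in the absence of a subdivided \<open>K\<^sub>4\<close>\<close>

lemma successively_join:
  assumes "successively P (x # xs @ [y])" "successively P (y # ys)"
  shows "successively P (x # xs @ y # ys)"
  using assms by (auto simp: successively_append_iff successively_Cons hd_append)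

lemma successively_split:
  assumes "successively P (xs @ x # ys @ y # zs)"
  shows "successively P (x # ys @ [y])"
  using assms by (auto simp: successively_append_iff successively_Cons hd_append)

text \<open>Take the last vertex \<open>y\<close> in \<open>X\<close>, then the first vertex
  \<open>z\<close> in \<open>Y\<close> after it. The last clause lets a nonempty \<open>q\<close>
  yield a nonempty \<open>s\<close> when nothing is cut off.\<close>

lemma first_passage:
  assumes suc: "successively P (a # q @ [b])" and dis: "distinct (a # q @ [b])"
    and "a \<in> X" "b \<in> Y" "X \<inter> Y = {}"
  obtains y s z where "y \<in> X" "z \<in> Y" "set s \<subseteq> set q - X - Y"
    "successively P (y # s @ [z])" "distinct (y # s @ [z])" "y = a \<Longrightarrow> z = b \<Longrightarrow> s = q"
proof -
  have "\<exists>x\<in>set (a # q). x \<in> X" using assms by auto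
  then obtain ys y zs where 1: "a # q = ys @ y # zs" "y \<in> X" "\<forall>v\<in>set zs. v \<notin> X"
    by (rule split_list_last_propE)
  have "\<exists>x\<in>set (zs @ [b]). x \<in> Y" using assms by auto
  then obtain s z t where 2: "zs @ [b] = s @ z # t" "z \<in> Y" "\<forall>v\<in>set s. v \<notin> Y"
    by (rule split_list_first_propE)
  have eq: "a # q @ [b] = ys @ y # s @ z # t" using 1(1) 2(1) by (metis append.assoc append_Cons)
  have "set s \<subseteq> set zs"
    using 2(1) by (cases t rule: rev_cases) auto
  moreover have "set zs \<subseteq> set q" using 1(1) by (cases ys) auto
  ultimately have "set s \<subseteq> set q - X - Y" using 1(3) 2(3) by auto
  moreover have "successively P (y # s @ [z])"
    using suc unfolding eq by (rule successively_split)
  moreover have "distinct (y # s @ [z])" using dis unfolding eq by auto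
  moreover have "s = q" if "y = a" "z = b"
  proof -
    have "ys = []" using 1(1) dis that by (cases ys) auto
    moreover have "t = []" using dis that unfolding eq
      by (metis append_is_Nil_conv distinct.simps(2) distinct_append eq last_ConsR last_appendR last_in_set last_snoc list.distinct(1))
    ultimately show ?thesis using 1(1) 2(1) by auto
  qed
  ultimately show thesis using that 1(2) 2(2) by blast
qed

section \<open>The forbidden subdivision and two disjoint paths\<close>

text \<open>A cycle is listed from a base vertex \<open>x\<close>, so \<open>Suc (length xs)\<close>
  is its length; \<open>2 \<le> length xs\<close> excludes going back and forth along one
  edge.\<close>

locale mod4_cycles =
  fixes adj :: "'a \<Rightarrow> 'a \<Rightarrow> bool"
  assumes adj_sym: "adj x y \<Longrightarrow> adj y x"
    and adj_irrefl: "\<not> adj x x"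
    and cycle_mod4: "distinct (x # xs) \<Longrightarrow> 2 \<le> length xs \<Longrightarrow> successively adj (x # xs @ [x])
      \<Longrightarrow> Suc (length xs) mod 4 = 2"
begin

text \<open>Only the inner vertices \<open>q\<close> are confined to \<open>S\<close>; the ends may
  lie outside. An empty \<open>q\<close> is the single edge \<open>ab\<close>, hence the
  nonemptiness conditions in later statements.\<close>

definition link :: "'a set \<Rightarrow> 'a \<Rightarrow> 'a list \<Rightarrow> 'a \<Rightarrow> bool" where
  "link S a q b \<longleftrightarrow> distinct (a # q @ [b]) \<and> set q \<subseteq> S \<and> successively adj (a # q @ [b])"

lemma successively_rev_adj: "successively adj (rev xs) = successively adj xs"
  unfolding successively_rev using adj_sym by (metis (mono_tags, lifting) successively_mono)

lemma successively_flip: "successively adj (a # q @ [b]) \<Longrightarrow> successively adj (b # rev q @ [a])"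
  using successively_rev_adj[of "a # q @ [b]"] by simp

lemma link_rev: "link S a q b \<Longrightarrow> link S b (rev q) a"
  using successively_flip[of a q b] unfolding link_def by auto

text \<open>The branch vertices are \<open>u\<close>, \<open>y\<close>, \<open>w\<close>,
  \<open>z\<close>; the arms \<open>a\<close>, \<open>b\<close>, \<open>c\<close>, \<open>d\<close>
  form a cycle with chords \<open>s\<close> and \<open>q\<close>. All seven cycles of the
  subdivision are used: the outer one, two pairs of triangles sharing a chord, and the two that use
  both chords.\<close>

lemma no_K4_subdivision:
  assumes dis: "distinct (u # a @ y # b @ w # c @ z # d @ s @ q)"
    and arcs: "successively adj (u # a @ [y])" "successively adj (y # b @ [w])"
      "successively adj (w # c @ [z])" "successively adj (z # d @ [u])"
      "successively adj (y # s @ [z])" "successively adj (u # q @ [w])"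
  shows False
proof -
  note J = successively_join and R = successively_flip
  note disjoint = Int_Un_distrib Int_Un_distrib2 Int_commute
  have k1: "(length a + length b + length c + length d + 4) mod 4 = 2"
    using cycle_mod4[of u "a @ y # b @ w # c @ z # d"] dis
      J[OF arcs(1) J[OF arcs(2) J[OF arcs(3) arcs(4)]]]
    by (auto simp: disjoint add_ac)
  have k2: "(length a + length s + length d + 3) mod 4 = 2"
    using cycle_mod4[of u "a @ y # s @ z # d"] dis
      J[OF arcs(1) J[OF arcs(5) arcs(4)]]
    by (auto simp: disjoint add_ac)
  have k3: "(length b + length c + length s + 3) mod 4 = 2"
    using cycle_mod4[of y "b @ w # c @ z # rev s"] dis
      J[OF arcs(2) J[OF arcs(3) R[OF arcs(5)]]]
    by (auto simp: disjoint add_ac)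
  have k4: "(length a + length b + length q + 3) mod 4 = 2"
    using cycle_mod4[of u "a @ y # b @ w # rev q"] dis
      J[OF arcs(1) J[OF arcs(2) R[OF arcs(6)]]]
    by (auto simp: disjoint add_ac)
  have k5: "(length c + length d + length q + 3) mod 4 = 2"
    using cycle_mod4[of w "c @ z # d @ u # q"] dis
      J[OF arcs(3) J[OF arcs(4) arcs(6)]]
    by (auto simp: disjoint add_ac)
  have k6: "(length a + length s + length c + length q + 4) mod 4 = 2"
    using cycle_mod4[of u "a @ y # s @ z # rev c @ w # rev q"] dis
      J[OF arcs(1) J[OF arcs(5) J[OF R[OF arcs(3)] R[OF arcs(6)]]]]
    by (auto simp: disjoint add_ac)
  have k7: "(length b + length s + length d + length q + 4) mod 4 = 2"
    using cycle_mod4[of w "rev b @ y # s @ z # d @ u # q"] dis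
      J[OF R[OF arcs(2)] J[OF arcs(5) J[OF arcs(4) arcs(6)]]]
    by (auto simp: disjoint add_ac)
  have add: "(m + n) mod 4 = 0" if "m mod 4 = 2" "n mod 4 = 2" for m n :: nat
    using that by presburger
  define p where "p = length a + length b + length c + length d"
  \<comment> \<open>Modulo 4 this gives \<open>p = 2\<close>; the next two lines make
    \<open>2 * length s\<close> and \<open>2 * length q\<close> vanish, so the last sum would be 2
    instead of 0.\<close>
  have "(p + 4) mod 4 = 2" using k1 unfolding p_def .
  moreover have "(p + 2 * length s + 6) mod 4 = 0"
    using add[OF k2 k3] unfolding p_def by (simp add: algebra_simps)
  moreover have "(p + 2 * length q + 6) mod 4 = 0"
    using add[OF k4 k5] unfolding p_def by (simp add: algebra_simps)
  moreover have "(p + 2 * length s + 2 * length q + 8) mod 4 = 0"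
    using add[OF k6 k7] unfolding p_def by (simp add: algebra_simps)
  ultimately show False by presburger
qed

text \<open>
  Menger's theorem for two paths. The lists \<open>a\<close>, \<open>d\<close> are two disjoint ways from \<open>u\<close> to \<open>i\<close> and \<open>b\<close>
  continues to \<open>w\<close>; a detour around \<open>i\<close> yields two ways from \<open>u\<close> to a vertex closer to \<open>w\<close>.
  Initially \<open>a = d = []\<close>, where both ways are the same edge.
\<close>
lemma two_disjoint_links:
  assumes nocut: "\<And>x. x \<in> U \<Longrightarrow> \<exists>r. r \<noteq> [] \<and> link (U - {x}) u r w"
    and "u \<notin> U" "w \<notin> U" "u \<noteq> w"
    and "set a \<union> set d \<union> set b \<union> {i} \<subseteq> U"
    and "distinct (u # a @ d @ i # b @ [w])"
    and "successively adj (u # a @ [i])" "successively adj (u # d @ [i])" "successively adj (i # b @ [w])"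
  shows "\<exists>p q. p \<noteq> [] \<and> q \<noteq> [] \<and> link U u p w \<and> link U u q w \<and> set p \<inter> set q = {}"
  using assms(5-)
proof (induction "length b" arbitrary: a d i b rule: less_induct)
  case less
  \<comment> \<open>A path from \<open>u\<close> to \<open>w\<close> that avoids \<open>i\<close>
    must leave the two ways for the last time at some \<open>y\<close> and then first meet the rest
    of the path, beyond \<open>i\<close>, at some \<open>z\<close>.\<close>
  let ?X = "{u} \<union> set a \<union> set d" and ?Y = "set b \<union> {w}"
  have "i \<in> U" using less.prems by auto
  then obtain r where r: "r \<noteq> []" "link (U - {i}) u r w" using nocut by blast
  have "?X \<inter> ?Y = {}" using less.prems(2) by auto
  then obtain y s z where ysz: "y \<in> ?X" "z \<in> ?Y" "set s \<subseteq> set r - ?X - ?Y"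
    "successively adj (y # s @ [z])" "distinct (y # s @ [z])" "y = u \<Longrightarrow> z = w \<Longrightarrow> s = r"
    using first_passage[of adj u r w ?X ?Y] r(2) unfolding link_def by (metis Un_iff insertI1)
  have sU: "set s \<subseteq> U" "i \<notin> set s" using ysz(3) r(2) unfolding link_def by auto
  obtain b1 b2 where b: "b @ [w] = b1 @ z # b2"
    using ysz(2) by (metis (no_types, lifting) Un_iff empty_iff insert_iff list.set_intros(1)
        set_append split_list empty_set list.simps(15))
  have bset: "set b1 \<subseteq> set b" "z = w \<Longrightarrow> b1 = b"
    using b less.prems(2) by (cases b2 rule: rev_cases; auto)+
  have iz: "successively adj (i # b1 @ [z])"
    using less.prems(5) successively_split[of adj "[]" i b1 z b2] b by simp
  have dis: "distinct (u # a @ d @ i # b1 @ z # b2)" using less.prems(2) b by simp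
  have sd: "distinct s" "u \<notin> set s" "set s \<inter> set a = {}" "set s \<inter> set d = {}" "set s \<inter> set b1 = {}"
    using ysz(3,5) bset(1) by auto
  \<comment> \<open>The detour \<open>s\<close> extends the way containing \<open>y\<close> as far
    as \<open>z\<close>; a way not containing \<open>y\<close> continues through \<open>i\<close>
    and along \<open>b1\<close> to \<open>z\<close>. If \<open>y = u\<close> and
    \<open>z = w\<close>, then \<open>s = r\<close> is nonempty.\<close>
  have xy: "\<exists>x x'. successively adj (u # x @ [z]) \<and> successively adj (u # x' @ [z])
      \<and> set x \<union> set x' \<subseteq> set a \<union> set d \<union> set s \<union> {i} \<union> set b1 \<and> x' \<noteq> [] \<and> distinct (u # x @ x')
      \<and> (z = w \<longrightarrow> x \<noteq> [])"
  proof -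
    consider "y = u" | "y \<in> set a" | "y \<in> set d" using ysz(1) by auto
    then show ?thesis
    proof cases
      case 1
      have "successively adj (u # a @ i # b1 @ [z])"
        using successively_join[OF less.prems(3) iz] .
      moreover have "distinct (u # s @ a @ i # b1)" using dis sd sU(2) by auto
      ultimately show ?thesis using 1 ysz(4,6) r(1)
        by (intro exI[of _ s] exI[of _ "a @ i # b1"] conjI) auto
    next
      case 2
      then obtain a1 a2 where a: "a = a1 @ y # a2" by (meson split_list)
      have "successively adj (u # a1 @ [y])"
        using less.prems(3) successively_split[of adj "[]" u a1 y "a2 @ [i]"] a by simp
      from successively_join[OF this ysz(4)] successively_join[OF less.prems(4) iz]
      moreover have "distinct (u # (a1 @ y # s) @ d @ i # b1)"
        using dis sd sU(2) by (auto simp: a Int_Un_distrib Int_Un_distrib2 Int_commute)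
      ultimately show ?thesis
        by (intro exI[of _ "a1 @ y # s"] exI[of _ "d @ i # b1"] conjI) (auto simp: a)
    next
      case 3
      then obtain d1 d2 where d: "d = d1 @ y # d2" by (meson split_list)
      have "successively adj (u # d1 @ [y])"
        using less.prems(4) successively_split[of adj "[]" u d1 y "d2 @ [i]"] d by simp
      from successively_join[OF this ysz(4)] successively_join[OF less.prems(3) iz]
      moreover have "distinct (u # (d1 @ y # s) @ a @ i # b1)"
        using dis sd sU(2) by (auto simp: d Int_Un_distrib Int_Un_distrib2 Int_commute)
      ultimately show ?thesis
        by (intro exI[of _ "d1 @ y # s"] exI[of _ "a @ i # b1"] conjI) (auto simp: d)
    qed
  qed
  then obtain x x' where x: "successively adj (u # x @ [z])" "successively adj (u # x' @ [z])"
      "set x \<union> set x' \<subseteq> set a \<union> set d \<union> set s \<union> {i} \<union> set b1" "x' \<noteq> []" "distinct (u # x @ x')"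
      "z = w \<longrightarrow> x \<noteq> []" by (elim exE conjE) (rule that)
  have xU: "set x \<union> set x' \<subseteq> U" using x(3) less.prems(1) sU(1) bset(1) by blast
  show ?case
  proof (cases "z = w")
    case True
    then show ?thesis using x xU assms(2-4)
      by (intro exI[of _ x] exI[of _ x']) (auto simp: link_def)
  next
    case False
    then obtain b2' where b2: "b2 = b2' @ [w]" "b = b1 @ z # b2'"
      using b by (cases b2 rule: rev_cases) auto
    have "set (z # b2) \<inter> set (x @ x') = {}" using x(3) dis ysz(3) b2 by auto
    then have 1: "distinct (u # x @ x' @ z # b2' @ [w])" using x(5) dis b2 by auto
    have 2: "successively adj (z # b2' @ [w])"
      using less.prems(5) successively_split[of adj "i # b1" z b2' w "[]"] b2 by simp
    have 3: "set x \<union> set x' \<union> set b2' \<union> {z} \<subseteq> U"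
      using xU less.prems(1) b2(2) by simp
    have "length b2' < length b" using b2(2) by simp
    from less.hyps[OF this 3 1 x(1,2) 2] show ?thesis .
  qed
qed

section \<open>Connected vertex sets and cut vertices\<close>

abbreviation step_in :: "'a set \<Rightarrow> 'a \<Rightarrow> 'a \<Rightarrow> bool" where
  "step_in S \<equiv> \<lambda>x y. adj x y \<and> x \<in> S \<and> y \<in> S"

definition conn :: "'a set \<Rightarrow> bool" where
  "conn C \<longleftrightarrow> (\<forall>a\<in>C. \<forall>b\<in>C. (step_in C)\<^sup>*\<^sup>* a b)"

lemma rtranclp_imp_link:
  assumes "(step_in C)\<^sup>*\<^sup>* a b" "a \<noteq> b"
  obtains q where "link C a q b"
proof -
  have "a \<noteq> b \<longrightarrow> (\<exists>q. link C a q b)"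
    using assms(1)
  proof (induction rule: converse_rtranclp_induct)
    case base
    then show ?case by simp
  next
    case (step a c)
    show ?case
    proof (intro impI)
      assume ab: "a \<noteq> b"
      show "\<exists>q. link C a q b"
      proof (cases "c = b")
        case True
        then show ?thesis using step ab by (intro exI[of _ "[]"]) (auto simp: link_def)
      next
        case False
        then obtain q where q: "link C c q b" using step by blast
        show ?thesis
        proof (cases "a \<in> set q")
          \<comment> \<open>The loop from \<open>a\<close> back to \<open>a\<close> is cut
            off.\<close>
          case True
          then obtain q1 q2 where "q = q1 @ a # q2" by (meson split_list)
          then show ?thesis using q successively_split[of adj "c # q1" a q2 b "[]"]
            by (intro exI[of _ q2]) (auto simp: link_def)
        next
          case False
          then show ?thesis using q step ab adj_irrefl
            by (intro exI[of _ "c # q"]) (auto simp: link_def)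
        qed
      qed
    qed
  qed
  then show thesis using that assms(2) by blast
qed

lemma conn_link:
  assumes "conn C" "a \<in> C" "b \<in> C" "a \<noteq> b"
  obtains q where "link C a q b"
proof -
  have "(step_in C)\<^sup>*\<^sup>* a b" using assms(1-3) by (simp add: conn_def)
  then show thesis using assms(4) that by (rule rtranclp_imp_link)
qed

lemma conn_link_ends:
  assumes "conn C" "c \<in> C" "d \<in> C" "adj u c" "adj d w" "u \<notin> C" "w \<notin> C" "u \<noteq> w"
  obtains q where "link C u q w" "q \<noteq> []"
proof (cases "c = d")
  case True
  then have "link C u [c] w" using assms by (auto simp: link_def)
  then show ?thesis using that by blast
next
  case False
  then obtain q where "link C c q d" using assms conn_link by blast
  then have "link C u (c # q @ [d]) w" using assms
    by (auto simp: link_def successively_append_iff successively_Cons hd_append)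
  then show ?thesis using that by blast
qed

text \<open>Otherwise two disjoint paths through \<open>U\<close>, a path in \<open>U\<close>
  between them and the outer path \<open>q\<close> subdivide \<open>K\<^sub>4\<close>. The condition
  \<open>r \<noteq> []\<close> sets aside the edge \<open>uw\<close>, which avoids all of
  \<open>U\<close>.\<close>

lemma cut_vertex_exists:
  assumes U: "conn U" "u \<notin> U" "w \<notin> U" "u \<noteq> w"
    and c: "c \<in> U" "adj u c" and d: "d \<in> U" "adj d w"
    and q: "link (- U) u q w"
  shows "\<exists>x\<in>U. \<forall>r. r \<noteq> [] \<longrightarrow> \<not> link (U - {x}) u r w"
proof (rule ccontr)
  assume "\<not> ?thesis"
  then have nocut: "\<exists>r. r \<noteq> [] \<and> link (U - {x}) u r w" if "x \<in> U" for x using that by blast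
  obtain p where p: "link U u p w" "p \<noteq> []" using conn_link_ends[OF U(1) c(1) d(1) c(2) d(2) U(2-4)] .
  \<comment> \<open>Start of the Menger induction: the edge from \<open>u\<close> to the first inner
    vertex \<open>i\<close> counts as both ways, and \<open>b\<close> is the rest of the
    path.\<close>
  then obtain i b where ib: "p = i # b" by (cases p) auto
  have "\<exists>p q. p \<noteq> [] \<and> q \<noteq> [] \<and> link U u p w \<and> link U u q w \<and> set p \<inter> set q = {}"
    using p(1) ib U by (intro two_disjoint_links[OF nocut, where a = "[]" and d = "[]" and i = i and b = b])
      (auto simp: link_def)
  then obtain a b where ab: "a \<noteq> []" "b \<noteq> []" "link U u a w" "link U u b w" "set a \<inter> set b = {}" by blast
  have "hd a \<in> U" "hd b \<in> U" "hd a \<noteq> hd b" using ab by (auto simp: link_def dest!: hd_in_set)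
  then obtain t where t: "link U (hd a) t (hd b)" using conn_link U(1) by blast
  \<comment> \<open>The connection \<open>t\<close> is trimmed so that it touches the two paths only
    at its ends.\<close>
  then obtain y s z where s: "y \<in> set a" "z \<in> set b" "set s \<subseteq> set t - set a - set b"
    "successively adj (y # s @ [z])" "distinct (y # s @ [z])"
    using first_passage[of adj "hd a" t "hd b" "set a" "set b"] ab(1,2,5)
    unfolding link_def by (metis hd_in_set)
  obtain a1 a2 where a: "a = a1 @ y # a2" using s(1) by (meson split_list)
  obtain b1 b2 where b: "b = b1 @ z # b2" using s(2) by (meson split_list)
  have "set s \<subseteq> U" "set a \<subseteq> U" "set b \<subseteq> U" "set q \<subseteq> - U"
    using s(3) t ab(3,4) q by (auto simp: link_def)
  then have dq: "u \<notin> set s" "w \<notin> set s" "set s \<inter> set q = {}" "set a \<inter> set q = {}" "set b \<inter> set q = {}"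
    using U(2,3) by auto
  have ds: "set s \<inter> set a = {}" "set s \<inter> set b = {}" "distinct s" using s(3,5) by auto
  have "distinct (u # a @ w # b)" "distinct q" "u \<notin> set q" "w \<notin> set q"
    using ab(3-5) q by (auto simp: link_def)
  then have "distinct (u # a1 @ y # a2 @ w # rev b2 @ z # rev b1 @ s @ q)"
    using dq ds unfolding a b by (auto simp: Int_Un_distrib Int_Un_distrib2 Int_commute)
  moreover have "successively adj (u # a1 @ [y])" "successively adj (y # a2 @ [w])"
    using ab(3) successively_split[of adj "[]" u a1 y "a2 @ [w]"]
      successively_split[of adj "u # a1" y a2 w "[]"] by (auto simp: link_def a)
  moreover have "successively adj (u # b1 @ [z])" "successively adj (z # b2 @ [w])"
    using ab(4) successively_split[of adj "[]" u b1 z "b2 @ [w]"]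
      successively_split[of adj "u # b1" z b2 w "[]"] by (auto simp: link_def b)
  \<comment> \<open>The second path is reversed, so that both paths together are traversed as one
    cycle with chords \<open>s\<close> and \<open>q\<close>.\<close>
  ultimately show False
    using no_K4_subdivision[of u a1 y a2 w "rev b2" z "rev b1" s q] s(4) q
    by (simp add: link_def successively_flip)
qed

section \<open>Components\<close>

text \<open>Maximality is expressed as closure under adjacency within \<open>U\<close>.\<close>

definition component :: "'a set \<Rightarrow> 'a set \<Rightarrow> bool" where
  "component U C \<longleftrightarrow> C \<noteq> {} \<and> C \<subseteq> U \<and> conn C \<and> (\<forall>x\<in>C. \<forall>y\<in>U. adj x y \<longrightarrow> y \<in> C)"

lemma component_exists:
  assumes "v \<in> U"
  obtains C where "component U C" "v \<in> C"
proof -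
  let ?C = "{z. (step_in U)\<^sup>*\<^sup>* v z}"
  have CU: "?C \<subseteq> U" using assms by (auto elim: rtranclp.cases)
  \<comment> \<open>Walks from \<open>v\<close> stay among the reached vertices, so reachability in
    \<open>U\<close> is reachability inside the candidate component.\<close>
  have reach: "(step_in ?C)\<^sup>*\<^sup>* v z" if "(step_in U)\<^sup>*\<^sup>* v z" for z
    using that
  proof (induction rule: rtranclp_induct)
    case (step y z)
    then have "step_in ?C y z" by (auto intro: rtranclp.rtrancl_into_rtrancl)
    then show ?case using step.IH by (rule rtranclp.rtrancl_into_rtrancl[rotated])
  qed simp
  have "symp (step_in ?C)" using adj_sym by (auto intro: sympI)
  then have "symp (step_in ?C)\<^sup>*\<^sup>*" by (rule symp_rtranclp)
  then have "conn ?C" unfolding conn_def using reach by (auto dest: sympD intro: rtranclp_trans)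
  moreover have "\<forall>x\<in>?C. \<forall>y\<in>U. adj x y \<longrightarrow> y \<in> ?C"
    using CU by (auto intro: rtranclp.rtrancl_into_rtrancl)
  ultimately have "component U ?C" unfolding component_def using CU by auto
  then show thesis using that by auto
qed

lemma conn_closed_subset:
  assumes "conn D" "D \<inter> C \<noteq> {}" "D \<subseteq> U" "\<forall>x\<in>C. \<forall>y\<in>U. adj x y \<longrightarrow> y \<in> C"
  shows "D \<subseteq> C"
proof
  fix z assume "z \<in> D"
  obtain x where x: "x \<in> D" "x \<in> C" using assms by auto
  then have "(step_in D)\<^sup>*\<^sup>* x z" using assms \<open>z \<in> D\<close> by (auto simp: conn_def)
  then show "z \<in> C"
    by (induction rule: rtranclp_induct) (use x assms in auto)
qed

lemma component_of_conn: "conn U \<Longrightarrow> component U C \<Longrightarrow> C = U"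
  using conn_closed_subset[of U C U] unfolding component_def by blast

text \<open>By symmetry no edge leads from \<open>D\<close> back into the closed set
  \<open>C\<close>. This allows components to be handled one after another.\<close>

lemma component_Diff:
  assumes "component U C" "component (U - C) D"
  shows "component U D"
  using assms adj_sym unfolding component_def by blast

text \<open>Read from its end: a vertex in \<open>C\<close> would force its successor into
  \<open>C\<close>.\<close>

lemma successively_avoids_closed:
  assumes "successively adj xs" "set xs \<subseteq> V" "xs \<noteq> []" "last xs \<notin> C"
    and "C \<subseteq> V" "\<forall>x\<in>C. \<forall>y\<in>V. adj x y \<longrightarrow> y \<in> C"
  shows "set xs \<inter> C = {}"
  using assms(1-4)
proof (induction xs rule: induct_list012)
  case (3 x y zs)
  then have "set (y # zs) \<inter> C = {}" by auto
  then show ?case using 3 assms(5,6) by auto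
qed auto

text \<open>A path from outside \<open>C\<close> to \<open>x\<close> could only enter \<open>C\<close> through \<open>x\<close>.\<close>
lemma link_avoiding_component:
  assumes "conn U" "x \<in> U" "component (U - {x}) C" "c \<in> U - C" "adj c w" "w \<notin> U"
  obtains p where "link (U - C) x p w"
proof (cases "c = x")
  case True
  then have "link (U - C) x [] w" using assms by (auto simp: link_def)
  then show ?thesis using that by blast
next
  case False
  then obtain p where p: "link U x p c" using conn_link[OF assms(1,2)] assms(4) by (metis DiffD1)
  have "set (p @ [c]) \<inter> C = {}"
  proof (rule successively_avoids_closed)
    show "successively adj (p @ [c])" "set (p @ [c]) \<subseteq> U - {x}"
      using p assms(4) by (auto simp: link_def successively_Cons)
  qed (use assms(3,4) in \<open>auto simp: component_def\<close>)
  then have "link (U - C) x (p @ [c]) w" using p assms False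
    by (auto simp: link_def successively_append_iff successively_Cons hd_append)
  then show ?thesis using that by blast
qed

section \<open>Pieces hinged at two vertices\<close>

lemma link_mono: "link S a q b \<Longrightarrow> S \<subseteq> T \<Longrightarrow> link T a q b"
  unfolding link_def by auto

text \<open>
  The piece \<open>C\<close> is to be drawn along the already drawn edge \<open>{a, b}\<close>. This edge need not belong to
  the graph, so the path outside \<open>C\<close> has to be required separately.
\<close>
definition hinged :: "'a set set \<Rightarrow> 'a set \<Rightarrow> bool" where
  "hinged F C \<longleftrightarrow> (\<exists>a b. {a, b} \<in> F \<and> a \<noteq> b \<and> a \<notin> C \<and> b \<notin> C \<and>
     (\<forall>x\<in>C. \<forall>y. adj x y \<longrightarrow> y \<in> C \<union> {a, b}) \<and>
     ((\<exists>x\<in>C. adj a x) \<and> (\<exists>x\<in>C. adj b x) \<longrightarrow> (\<exists>q. link (- C) a q b)))"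

lemma hinged_mono: "hinged F C \<Longrightarrow> F \<subseteq> F' \<Longrightarrow> hinged F' C"
  unfolding hinged_def by (meson subsetD)

text \<open>Without a neighbour of \<open>w\<close>, the component \<open>D\<close> can only be
  attached at \<open>x\<close> and \<open>u\<close>. A path from \<open>x\<close> to
  \<open>u\<close> outside \<open>D\<close> leads through \<open>U - D\<close> to \<open>w\<close>
  and back along the outer path, or is the edge \<open>xu\<close> supplied by the choice of
  \<open>x\<close>.\<close>

lemma hinged_piece:
  assumes U: "conn U" "u \<notin> U" "w \<notin> U" "u \<noteq> w" "x \<in> U"
    and nb: "\<forall>y\<in>U. \<forall>z. adj y z \<longrightarrow> z \<in> U \<union> {u, w}"
    and ext: "(\<exists>c\<in>U. adj u c) \<and> (\<exists>d\<in>U. adj w d) \<longrightarrow> (\<exists>q. link (- U) u q w)"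
    and xu: "(\<exists>c\<in>U. adj u c) \<and> \<not> (\<exists>d\<in>U. adj w d) \<longrightarrow> adj x u"
    and D: "component (U - {x}) D" "\<not> (\<exists>d\<in>D. adj w d)"
  shows "hinged {{x, u}} D"
proof -
  have DU: "D \<subseteq> U - {x}" using D by (simp add: component_def)
  have "z \<in> D \<union> {x, u}" if "y \<in> D" "adj y z" for y z
  proof -
    have "z \<noteq> w" using that D(2) adj_sym by blast
    moreover have "z \<in> U \<union> {u, w}" using nb that DU by blast
    moreover have "z \<in> D" if "z \<in> U - {x}" using that \<open>y \<in> D\<close> \<open>adj y z\<close> D(1) by (simp add: component_def)
    ultimately show ?thesis by blast
  qed
  moreover have "\<exists>q. link (- D) x q u" if c: "c \<in> D" "adj u c" for c
  proof (cases "\<exists>d\<in>U. adj w d")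
    case True
    then obtain d where d: "d \<in> U" "adj w d" by blast
    obtain q where q: "link (- U) u q w" using ext c d DU by blast
    have "d \<in> U - D" "adj d w" using d D(2) adj_sym by auto
    then obtain p where p: "link (U - D) x p w"
      using link_avoiding_component[OF U(1,5) D(1)] U(3) by blast
    have "successively adj (x # p @ w # rev q @ [u])"
      using p q successively_join[of adj x p w "rev q @ [u]"] successively_flip[of u q w]
      by (simp add: link_def)
    moreover have "set p \<inter> set q = {}" "u \<notin> set p" "x \<notin> set q" "u \<noteq> x" "set p \<subseteq> - D" "set q \<subseteq> - D" "w \<notin> D"

      using p q U DU by (auto simp: link_def)
    moreover have "distinct (x # p @ [w])" "distinct (u # q @ [w])" using p q by (auto simp: link_def)
    ultimately have "link (- D) x (p @ w # rev q) u" unfolding link_def by auto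
    then show ?thesis by blast
  next
    case False
    then have "adj x u" using xu c DU by blast
    then have "link (- D) x [] u" using U by (auto simp: link_def)
    then show ?thesis by blast
  qed
  moreover have "x \<noteq> u" "x \<notin> D" "u \<notin> D" using U DU by auto
  ultimately show ?thesis unfolding hinged_def by (intro exI[of _ x] exI[of _ u]) blast
qed

text \<open>If \<open>U\<close> is attached to both \<open>u\<close> and \<open>w\<close>, a cut
  vertex leaves no component attached to both. Otherwise no component can be, and \<open>x\<close>
  is taken next to the one to which \<open>U\<close> is attached, if any.\<close>

lemma split_vertex_exists:
  assumes U: "conn U" "U \<noteq> {}" "u \<notin> U" "w \<notin> U" "u \<noteq> w"
    and nb: "\<forall>y\<in>U. \<forall>z. adj y z \<longrightarrow> z \<in> U \<union> {u, w}"
    and ext: "(\<exists>c\<in>U. adj u c) \<and> (\<exists>d\<in>U. adj w d) \<longrightarrow> (\<exists>q. link (- U) u q w)"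
  obtains x where "x \<in> U" "\<And>D. component (U - {x}) D \<Longrightarrow> hinged {{x, u}, {x, w}} D"
proof -
  let ?au = "\<exists>c\<in>U. adj u c" and ?aw = "\<exists>d\<in>U. adj w d"
  have "\<exists>x\<in>U. (\<forall>D. component (U - {x}) D \<longrightarrow> \<not> ((\<exists>c\<in>D. adj u c) \<and> (\<exists>d\<in>D. adj w d)))
    \<and> (?au \<and> \<not> ?aw \<longrightarrow> adj x u) \<and> (?aw \<and> \<not> ?au \<longrightarrow> adj x w)"
  proof (cases "?au \<and> ?aw")
    case True
    then obtain c d where cd: "c \<in> U" "adj u c" "d \<in> U" "adj w d" by blast
    obtain q where "link (- U) u q w" using ext cd by blast
    then obtain x where x: "x \<in> U" "\<And>r. r \<noteq> [] \<Longrightarrow> \<not> link (U - {x}) u r w"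
      using cut_vertex_exists[OF U(1,3-5) cd(1,2,3) adj_sym[OF cd(4)]] by blast
    have "\<not> ((\<exists>c\<in>D. adj u c) \<and> (\<exists>d\<in>D. adj w d))" if D: "component (U - {x}) D" for D
    proof
      assume "(\<exists>c\<in>D. adj u c) \<and> (\<exists>d\<in>D. adj w d)"
      then obtain c d where "c \<in> D" "adj u c" "d \<in> D" "adj d w" using adj_sym by blast
      moreover have "conn D" "D \<subseteq> U - {x}" "u \<notin> D" "w \<notin> D" using D U by (auto simp: component_def)
      ultimately obtain q where "link D u q w" "q \<noteq> []"
        using conn_link_ends U(5) by metis
      then show False using x(2) link_mono \<open>D \<subseteq> U - {x}\<close> by blast
    qed
    then show ?thesis using x(1) True by blast
  next
    case False
    obtain x where "x \<in> U" "?au \<longrightarrow> adj x u" "?aw \<longrightarrow> adj x w"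
      using False U(2) adj_sym by (metis all_not_in_conv)
    moreover have "D \<subseteq> U" if "component (U - {x}) D" for D using that by (auto simp: component_def)
    ultimately show ?thesis using False by (intro bexI[of _ x]) blast+
  qed
  then obtain x where x: "x \<in> U"
    and nob: "\<And>D. component (U - {x}) D \<Longrightarrow> \<not> ((\<exists>c\<in>D. adj u c) \<and> (\<exists>d\<in>D. adj w d))"
    and xu: "?au \<and> \<not> ?aw \<longrightarrow> adj x u" and xw: "?aw \<and> \<not> ?au \<longrightarrow> adj x w" by blast
  have "hinged {{x, u}, {x, w}} D" if D: "component (U - {x}) D" for D
  proof (cases "\<exists>d\<in>D. adj w d")
    case False
    have "hinged {{x, u}} D"
      using hinged_piece[OF U(1,3-5) x nb ext xu D False] .
    then show ?thesis by (rule hinged_mono) auto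
  next
    case True
    then have nu: "\<not> (\<exists>d\<in>D. adj u d)" using nob[OF D] by blast
    \<comment> \<open>The other side follows by exchanging \<open>u\<close> and
      \<open>w\<close>.\<close>
    have nb': "\<forall>y\<in>U. \<forall>z. adj y z \<longrightarrow> z \<in> U \<union> {w, u}" using nb by blast
    have ext': "(\<exists>c\<in>U. adj w c) \<and> (\<exists>d\<in>U. adj u d) \<longrightarrow> (\<exists>q. link (- U) w q u)"
      using ext link_rev by blast
    have "hinged {{x, w}} D"
      using hinged_piece[OF U(1,4,3) U(5)[symmetric] x nb' ext' xw D nu] .
    then show ?thesis by (rule hinged_mono) auto
  qed
  then show thesis using that x by blast
qed

section \<open>Recursive construction of the drawing\<close>

text \<open>A disconnected \<open>U\<close> is drawn one component first and then the rest, whose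
  hinges survive in the larger \<open>F\<close>. A connected \<open>U\<close> has a vertex
  \<open>x\<close> that is placed over its hinge, and the components of \<open>U - {x}\<close> hang
  on the two new segments.\<close>

lemma straight_drawing_absorbs:
  assumes "finite U" "straight_drawable W F" "U \<inter> W = {}" "\<And>C. component U C \<Longrightarrow> hinged F C"
  shows "\<exists>F'. F \<subseteq> F' \<and> straight_drawable (W \<union> U) F' \<and> (\<forall>x\<in>U. \<forall>y. adj x y \<longrightarrow> {x, y} \<in> F')"
  using assms
proof (induction "card U" arbitrary: U W F rule: less_induct)
  case less
  show ?case
  proof (cases "U = {}")
    case True
    then show ?thesis using less.prems(2) by (intro exI[of _ F]) auto
  next
    case False
    then obtain v where "v \<in> U" by blast
    then obtain C where C: "component U C" "v \<in> C" using component_exists by blast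
    then have C': "C \<subseteq> U" "C \<noteq> {}" "conn C" by (auto simp: component_def)
    show ?thesis
    proof (cases "C = U")
      case False
      have fin: "finite C" "finite (U - C)" using C'(1) less.prems(1) finite_subset by auto
      have "card C < card U" using C' False less.prems(1) by (meson psubsetI psubset_card_mono)
      moreover have "hinged F D" if "component C D" for D
        using component_of_conn[OF C'(3) that] less.prems(4)[OF C(1)] by simp
      moreover have "C \<inter> W = {}" using less.prems(3) C'(1) by auto
      ultimately obtain F1 where F1: "F \<subseteq> F1" "straight_drawable (W \<union> C) F1"
        "\<forall>x\<in>C. \<forall>y. adj x y \<longrightarrow> {x, y} \<in> F1"
        using less.hyps[of C W F] fin(1) less.prems(2) by blast
      have "card (U - C) < card U" using C' less.prems(1) by (intro psubset_card_mono) auto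
      moreover have "hinged F1 D" if "component (U - C) D" for D
        using component_Diff[OF C(1) that] less.prems(4) hinged_mono F1(1) by blast
      moreover have "(U - C) \<inter> (W \<union> C) = {}" using less.prems(3) by auto
      ultimately obtain F2 where F2: "F1 \<subseteq> F2" "straight_drawable (W \<union> C \<union> (U - C)) F2"
        "\<forall>x\<in>U - C. \<forall>y. adj x y \<longrightarrow> {x, y} \<in> F2"
        using less.hyps[of "U - C" "W \<union> C" F1] fin(2) F1(2) by blast
      have "W \<union> C \<union> (U - C) = W \<union> U" using C'(1) by auto
      moreover have "{x, y} \<in> F2" if "x \<in> U" "adj x y" for x y
        using F1(3) F2(1,3) that by (cases "x \<in> C") blast+
      ultimately show ?thesis using F1(1) F2(1,2) by (intro exI[of _ F2]) auto
    next
      case True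
      then have "hinged F U" using less.prems(4) C(1) by blast
      then obtain a b where ab: "{a, b} \<in> F" "a \<noteq> b" "a \<notin> U" "b \<notin> U"
        and nb: "\<forall>x\<in>U. \<forall>y. adj x y \<longrightarrow> y \<in> U \<union> {a, b}"
        and ext: "(\<exists>x\<in>U. adj a x) \<and> (\<exists>x\<in>U. adj b x) \<longrightarrow> (\<exists>q. link (- U) a q b)"
        unfolding hinged_def by blast
      obtain x where x: "x \<in> U" and D: "\<And>D. component (U - {x}) D \<Longrightarrow> hinged {{x, a}, {x, b}} D"
        using split_vertex_exists[OF C'(3)[unfolded True] False ab(3,4,2) nb ext] by blast
      let ?F = "insert {x, a} (insert {x, b} F)"
      have "straight_drawable (insert x W) ?F"
        using straight_drawable_extend[OF less.prems(2) ab(1)] x less.prems(3) by blast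
      moreover have "card (U - {x}) < card U" using x less.prems(1) by (meson card_Diff1_less)
      moreover have "(U - {x}) \<inter> insert x W = {}" using less.prems(3) by auto
      moreover have "hinged ?F E" if "component (U - {x}) E" for E
        using D[OF that] by (rule hinged_mono) auto
      ultimately obtain F' where F': "?F \<subseteq> F'" "straight_drawable (insert x W \<union> (U - {x})) F'"
        "\<forall>y\<in>U - {x}. \<forall>z. adj y z \<longrightarrow> {y, z} \<in> F'"
        using less.hyps[of "U - {x}" "insert x W" ?F] less.prems(1) by blast
      have "insert x W \<union> (U - {x}) = W \<union> U" using x by auto
      moreover have "{y, z} \<in> F'" if "y \<in> U" "adj y z" for y z
      proof (cases "y = x")
        case True
        \<comment> \<open>Edges from \<open>x\<close> into the rest of \<open>U\<close> are drawn
          from their other end; edges to \<open>a\<close> or \<open>b\<close> are the segments just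
          added.\<close>
        have "z \<in> U - {x} \<union> {a, b}" using nb that True adj_irrefl by blast
        then show ?thesis
        proof (elim UnE)
          assume "z \<in> U - {x}"
          then have "{z, y} \<in> F'" using F'(3) adj_sym[OF that(2)] by blast
          then show ?thesis by (simp add: insert_commute)
        qed (use F'(1) True in auto)
      qed (use F'(3) that in blast)
      ultimately show ?thesis using F'(1,2) by (intro exI[of _ F']) auto
    qed
  qed
qed

text \<open>The drawing starts with one edge \<open>uw\<close>. All components of the rest hang on
  it, and the edge itself is the required outer path.\<close>

lemma straight_drawing_exists:
  assumes "finite V" "\<And>x y. adj x y \<Longrightarrow> x \<in> V" "adj u w"
  obtains F where "straight_drawable V F" "\<And>x y. adj x y \<Longrightarrow> {x, y} \<in> F"
proof -
  have uw: "u \<noteq> w" "u \<in> V" "w \<in> V" using assms(2,3) adj_irrefl adj_sym by blast+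
  have "hinged {{u, w}} C" if "component (V - {u, w}) C" for C
  proof -
    have C: "C \<subseteq> V - {u, w}" "\<And>x y. x \<in> C \<Longrightarrow> adj x y \<Longrightarrow> y \<in> V - {u, w} \<Longrightarrow> y \<in> C"
      using that by (auto simp: component_def)
    have "link (- C) u [] w" using assms(3) uw by (simp add: link_def)
    moreover have "y \<in> C \<union> {u, w}" if "x \<in> C" "adj x y" for x y
      using C(2)[OF that] assms(2) adj_sym that(2) by blast
    ultimately show ?thesis unfolding hinged_def
      using C(1) uw(1) by (intro exI[of _ u] exI[of _ w]) blast
  qed
  then obtain F where F: "{{u, w}} \<subseteq> F" "straight_drawable ({u, w} \<union> (V - {u, w})) F"
    "\<forall>x\<in>V - {u, w}. \<forall>y. adj x y \<longrightarrow> {x, y} \<in> F"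
    using straight_drawing_absorbs[OF _ straight_drawable_edge[OF uw(1)], of "V - {u, w}"] assms(1) by auto
  have "{u, w} \<union> (V - {u, w}) = V" using uw by auto
  moreover have "{x, y} \<in> F" if "adj x y" for x y
  proof (cases "x \<in> {u, w} \<and> y \<in> {u, w}")
    case True
    then have "{x, y} = {u, w}" using that adj_irrefl by auto
    then show ?thesis using F(1) by simp
  next
    case False
    moreover have "x \<in> V" "y \<in> V" using that assms(2) adj_sym by blast+
    ultimately have "{x, y} \<in> F \<or> {y, x} \<in> F" using F(3) that adj_sym by blast
    then show ?thesis by (simp add: insert_commute)
  qed
  ultimately show thesis using that F(2) by simp
qed

end

section \<open>Planarity\<close>

text \<open>Library cycles are lists of arcs, those of the locale lists of vertices; an arc is
  picked for each consecutive pair.\<close>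

lemma (in graph) ex_arc_walk:
  assumes "successively (\<lambda>x y. (x, y) \<in> arcs_ends G) (x # xs)" "x \<in> verts G"
  shows "\<exists>p. awalk x p (last (x # xs)) \<and> awalk_verts x p = x # xs"
  using assms
proof (induction xs arbitrary: x)
  case Nil
  then show ?case by (intro exI[of _ "[]"]) (simp add: awalk_Nil_iff)
next
  case (Cons y ys)
  then obtain e where e: "e \<in> arcs G" "tail G e = x" "head G e = y"
    by (auto simp: arcs_ends_def arc_to_ends_def)
  then have "y \<in> verts G" by auto
  then obtain p where "awalk y p (last (y # ys))" "awalk_verts y p = y # ys"
    using Cons by (auto simp: successively_Cons)
  then show ?case using e by (intro exI[of _ "e # p"]) (simp add: awalk_Cons_iff)
qed

lemma eps2_mod4_cycles:
  assumes "G \<in> eps2"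
  shows "mod4_cycles (\<lambda>x y. (x, y) \<in> arcs_ends G)"
proof -
  interpret graph G using assms by (simp add: eps2_def euler_graph_def)
  show ?thesis
  proof
    show "(y, x) \<in> arcs_ends G" if "(x, y) \<in> arcs_ends G" for x y
      using that sym_arcs by (simp add: symmetric_def symD)
    show "(x, x) \<notin> arcs_ends G" for x
      using no_loops by (auto simp: arcs_ends_def arc_to_ends_def)
    fix x xs
    assume xs: "distinct (x # xs)" "2 \<le> length xs"
      "successively (\<lambda>x y. (x, y) \<in> arcs_ends G) (x # xs @ [x])"
    have "(x, hd xs) \<in> arcs_ends G" using xs(2,3) by (cases xs) auto
    then have "x \<in> verts G" by (auto simp: arcs_ends_def arc_to_ends_def)
    then obtain p where p: "awalk x p x" "awalk_verts x p = x # xs @ [x]"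
      using ex_arc_walk[OF xs(3)] by auto
    have len: "length p = Suc (length xs)"
      using arg_cong[OF p(2), of length] by (simp add: length_awalk_verts)
    have "undirected_cycle G p"
      unfolding undirected_cycle_def cycle_def using p xs(1,2) len by (intro conjI exI[of _ x]) auto
    then show "Suc (length xs) mod 4 = 2"
      using assms len by (auto simp: eps2_def)
  qed
qed

theorem theorem15:
  fixes G :: "('a, 'b) pre_digraph"
  assumes "G \<in> eps2"
  shows "planar G"
proof -
  interpret graph G using assms by (simp add: eps2_def euler_graph_def)
  interpret mod4_cycles "\<lambda>x y. (x, y) \<in> arcs_ends G" using assms by (rule eps2_mod4_cycles)
  show ?thesis
  \<comment> \<open>Without arcs there is no edge to start the recursion from.\<close>
  proof (cases "arcs_ends G = {}")
    case True
    then have "undirected_edges G = {}" by (simp add: undirected_edges_def)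
    then show ?thesis
      using planar_of_straight_drawable[OF straight_drawable_no_edges[OF finite_verts]] by simp
  next
    case False
    then obtain u w where uw: "(u, w) \<in> arcs_ends G" by auto
    have "x \<in> verts G" if "(x, y) \<in> arcs_ends G" for x y
      using that by (auto simp: arcs_ends_def arc_to_ends_def)
    then obtain F where "straight_drawable (verts G) F" "\<And>x y. (x, y) \<in> arcs_ends G \<Longrightarrow> {x, y} \<in> F"
      using straight_drawing_exists[OF finite_verts _ uw] by blast
    then show ?thesis
      by (intro planar_of_straight_drawable) (auto simp: undirected_edges_def)
  qed
qed

end
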